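(* Let $(X,b)$ be a connected weighted graph. Then the following statements are equivalent: (i) There exists a constant $c>0$ with $\|f\|_{\mathcal V}^2\le c\,\mathcal E(f)$ for all $f\in\mathcal D$. (ii) $\mathcal D\subset \ell^\infty(X)$. (iii) $\mathrm{diam}_r(X)<\infty$.
   Context: A weighted graph $(X,b)$ consists of a nonempty countable (finite or infinite) set $X$ and a symmetric function $b:X\times X\to[0,\infty)$ with $b(x,x)=0$ for all $x\in X$ (no summability or local finiteness is assumed). It is connected if for any $x,y\in X$ there are $x=x_0,x_1,\dots,x_k=y$ with $b(x_j,x_{j+1})>0$ for $0\le j<k$. Let $\mathcal D=\{f:X\to\mathbb R\mid \sum_{x,y\in X}b(x,y)|f(x)-f(y)|^2<\infty\}$ and $\mathcal E(f)=\frac12\sum_{x,y\in X}b(x,y)(f(x)-f(y))^2$ for $f\in\mathcal D$. For $f:X\to\mathbb R$ put $\|f\|_{\mathcal V}=\sup f-\inf f\in[0,\infty]$. $\ell^\infty(X)$ is the set of bounded real functions on $X$. For $x,y\in X$, $r(x,y)$ is the smallest number with $|f(x)-f(y)|^2\le r(x,y)\,\mathcal E(f)$ for all $f\in\mathcal D$; equivalently $r(x,y)=\sup\{|f(x)-f(y)|^2\mid f\in\mathcal D,\ \mathcal E(f)\le1\}$. $\mathrm{diam}_r(X)=\sup_{x,y\in X}r(x,y)\in[0,\infty]$. *)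

theory Defs
  imports "HOL-Analysis.Analysis"
begin

locale weighted_graph =
  fixes X :: "'a set" and b :: "'a \<Rightarrow> 'a \<Rightarrow> real"
  assumes vertices_nonempty: "X \<noteq> {}"
    and vertices_countable: "countable X"
    and weight_nonneg: "x \<in> X \<Longrightarrow> y \<in> X \<Longrightarrow> 0 \<le> b x y"
    and weight_sym: "x \<in> X \<Longrightarrow> y \<in> X \<Longrightarrow> b x y = b y x"
    and weight_diag: "x \<in> X \<Longrightarrow> b x x = 0"

definition connected_graph :: "'a set \<Rightarrow> ('a \<Rightarrow> 'a \<Rightarrow> real) \<Rightarrow> bool" where
  "connected_graph X b \<longleftrightarrow>
     (\<forall>x\<in>X. \<forall>y\<in>X. \<exists>(k::nat) p. p 0 = x \<and> p k = y \<and> (\<forall>j\<le>k. p j \<in> X) \<and>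
        (\<forall>j<k. 0 < b (p j) (p (Suc j))))"

text \<open>Real functions on the vertex set are the extensional functions on \<open>X\<close>, so that
  functions with the same values on \<open>X\<close> are equal. The summands being nonnegative,
  summability is finiteness of the double sum.\<close>

definition finite_energy :: "'a set \<Rightarrow> ('a \<Rightarrow> 'a \<Rightarrow> real) \<Rightarrow> ('a \<Rightarrow> real) set" where
  "finite_energy X b =
     {f \<in> X \<rightarrow>\<^sub>E UNIV. (\<lambda>(x, y). b x y * \<bar>f x - f y\<bar>\<^sup>2) summable_on X \<times> X}"

definition energy :: "'a set \<Rightarrow> ('a \<Rightarrow> 'a \<Rightarrow> real) \<Rightarrow> ('a \<Rightarrow> real) \<Rightarrow> real" where
  "energy X b f = 1 / 2 * (\<Sum>\<^sub>\<infinity>(x, y)\<in>X \<times> X. b x y * (f x - f y)\<^sup>2)"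

definition bounded_functions :: "'a set \<Rightarrow> ('a \<Rightarrow> real) set" where
  "bounded_functions X = {f \<in> X \<rightarrow>\<^sub>E UNIV. bounded (f ` X)}"

text \<open>For nonempty \<open>X\<close> the supremum is not \<open>-\<infinity>\<close> and the infimum is not \<open>\<infinity>\<close>, so the
  difference is never of the form \<open>\<infinity> - \<infinity>\<close>.\<close>

definition variation_norm :: "'a set \<Rightarrow> ('a \<Rightarrow> real) \<Rightarrow> ereal" where
  "variation_norm X f = (SUP x\<in>X. ereal (f x)) - (INF x\<in>X. ereal (f x))"

text \<open>The infimum is a minimum on connected graphs, see \<open>resistance_smallest\<close> below.\<close>

definition resistance :: "'a set \<Rightarrow> ('a \<Rightarrow> 'a \<Rightarrow> real) \<Rightarrow> 'a \<Rightarrow> 'a \<Rightarrow> ennreal" where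
  "resistance X b x y =
     Inf {C. \<forall>f\<in>finite_energy X b. ennreal (\<bar>f x - f y\<bar>\<^sup>2) \<le> C * ennreal (energy X b f)}"

definition resistance_diameter :: "'a set \<Rightarrow> ('a \<Rightarrow> 'a \<Rightarrow> real) \<Rightarrow> ennreal" where
  "resistance_diameter X b = (SUP x\<in>X. SUP y\<in>X. resistance X b x y)"

context weighted_graph
begin

lemma energy_nonneg: "0 \<le> energy X b f"
  unfolding energy_def by (auto intro!: mult_nonneg_nonneg infsum_nonneg weight_nonneg)

lemma energy_zero_imp_const:
  assumes "connected_graph X b" "f \<in> finite_energy X b" "energy X b f = 0" "x \<in> X" "y \<in> X"
  shows "f x = f y"
proof -
  have s: "(\<lambda>(x, y). b x y * (f x - f y)\<^sup>2) summable_on X \<times> X"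
    using assms(2) by (simp add: finite_energy_def)
  have z: "b u v * (f u - f v)\<^sup>2 = 0" if "u \<in> X" "v \<in> X" for u v
  proof -
    have "(\<lambda>(x, y). b x y * (f x - f y)\<^sup>2) (u, v) = 0"
      by (rule nonneg_infsum_le_0D[OF _ s, where x = "(u, v)"])
        (use assms(3) that in \<open>auto simp: energy_def weight_nonneg\<close>)
    then show ?thesis by simp
  qed
  obtain k :: nat and p where p: "p 0 = x" "p k = y" "\<forall>j\<le>k. p j \<in> X"
    "\<forall>j<k. 0 < b (p j) (p (Suc j))"
    using assms(1,4,5) unfolding connected_graph_def by blast
  have "f (p j) = f x" if "j \<le> k" for j
    using that
  proof (induction j)
    case 0
    then show ?case using p by simp
  next
    case (Suc j)
    then show ?case using z[of "p j" "p (Suc j)"] p(3,4) by (auto simp: Suc_le_eq)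
  qed
  then show ?thesis using p(2) by auto
qed

lemma resistance_smallest:
  assumes "connected_graph X b" "x \<in> X" "y \<in> X"
  shows "f \<in> finite_energy X b \<Longrightarrow>
      ennreal (\<bar>f x - f y\<bar>\<^sup>2) \<le> resistance X b x y * ennreal (energy X b f)"
    and "(\<And>f. f \<in> finite_energy X b \<Longrightarrow> ennreal (\<bar>f x - f y\<bar>\<^sup>2) \<le> C * ennreal (energy X b f))
      \<Longrightarrow> resistance X b x y \<le> C"
proof -
  assume f: "f \<in> finite_energy X b"
  show "ennreal (\<bar>f x - f y\<bar>\<^sup>2) \<le> resistance X b x y * ennreal (energy X b f)"
  proof (cases "energy X b f = 0")
    case True
    then show ?thesis using energy_zero_imp_const[OF assms(1) f _ assms(2,3)] by simp
  next
    case False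
    then have pos: "0 < energy X b f" using energy_nonneg[of f] by linarith
    have "ennreal (\<bar>f x - f y\<bar>\<^sup>2) / ennreal (energy X b f) \<le> resistance X b x y"
      unfolding resistance_def
    proof (rule Inf_greatest, clarify)
      fix C assume "\<forall>f\<in>finite_energy X b. ennreal (\<bar>f x - f y\<bar>\<^sup>2) \<le> C * ennreal (energy X b f)"
      then show "ennreal (\<bar>f x - f y\<bar>\<^sup>2) / ennreal (energy X b f) \<le> C"
        using f pos by (intro divide_le_posI_ennreal) (auto simp: mult.commute)
    qed
    then have "ennreal (\<bar>f x - f y\<bar>\<^sup>2) / ennreal (energy X b f) * ennreal (energy X b f)
        \<le> resistance X b x y * ennreal (energy X b f)"
      by (rule mult_right_mono) simp
    then show ?thesis using pos by (simp add: ennreal_divide_times ennreal_mult_divide_eq)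
  qed
next
  assume "\<And>f. f \<in> finite_energy X b \<Longrightarrow> ennreal (\<bar>f x - f y\<bar>\<^sup>2) \<le> C * ennreal (energy X b f)"
  then show "resistance X b x y \<le> C"
    unfolding resistance_def by (intro Inf_lower) auto
qed

end

end

theory Submission
  imports Defs
begin

text \<open>
  All three statements are equivalent to a uniform bound \<open>(f x - f y)\<^sup>2 \<le> c * energy X b f\<close>, and the
  only step with content derives this bound from boundedness of all functions of finite energy.
  If the bound fails then, for a fixed vertex \<open>z\<close>, there are functions \<open>f\<^sub>n\<close> and vertices \<open>x\<^sub>n\<close> such
  that \<open>(f\<^sub>n x\<^sub>n - f\<^sub>n z)\<^sup>2\<close> exceeds \<open>16\<^sup>n\<close> times the energy of \<open>f\<^sub>n\<close>. Since \<open>t \<mapsto> \<bar>t\<bar>\<close> contracts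
  distances, suitable multiples \<open>g\<^sub>n\<close> of \<open>\<bar>f\<^sub>n - f\<^sub>n z\<bar>\<close> are nonnegative, vanish at \<open>z\<close>, have energy at
  most \<open>4\<^sup>-\<^sup>n\<close> and satisfy \<open>g\<^sub>n x\<^sub>n \<ge> 2\<^sup>n\<close>. Connectedness makes \<open>sup\<^sub>n g\<^sub>n\<close> finite at every vertex. Its
  energy is at most the sum of the energies of the \<open>g\<^sub>n\<close>, yet it is unbounded. Working with suprema
  of nonnegative functions avoids both completeness of the energy space and the uniform
  boundedness principle.
\<close>

section \<open>Suprema of real families and the variation norm\<close>

lemma abs_cSUP_diff_le:
  fixes u v :: "'i \<Rightarrow> real"
  assumes "A \<noteq> {}" "bdd_above (u ` A)" "bdd_above (v ` A)"
    and "\<And>i. i \<in> A \<Longrightarrow> \<bar>u i - v i\<bar> \<le> d"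
  shows "\<bar>(SUP i\<in>A. u i) - (SUP i\<in>A. v i)\<bar> \<le> d"
proof -
  have "(SUP i\<in>A. u i) \<le> (SUP i\<in>A. v i) + d"
  proof (rule cSUP_least[OF assms(1)])
    fix i assume i: "i \<in> A"
    show "u i \<le> (SUP i\<in>A. v i) + d"
      using cSUP_upper[OF i assms(3)] assms(4)[OF i] by linarith
  qed
  moreover have "(SUP i\<in>A. v i) \<le> (SUP i\<in>A. u i) + d"
  proof (rule cSUP_least[OF assms(1)])
    fix i assume i: "i \<in> A"
    show "v i \<le> (SUP i\<in>A. u i) + d"
      using cSUP_upper[OF i assms(2)] assms(4)[OF i] by linarith
  qed
  ultimately show ?thesis by linarith
qed

lemma variation_norm_ge:
  assumes "x \<in> X" "y \<in> X"
  shows "ereal (f x - f y) \<le> variation_norm X f"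
proof -
  have "ereal (f x) - ereal (f y) \<le> variation_norm X f"
    unfolding variation_norm_def by (intro ereal_minus_mono SUP_upper INF_lower assms)
  then show ?thesis by simp
qed

text \<open>With \<open>y\<close> fixed, the supremum is at most \<open>f y + d\<close> and hence a
  real \<open>s\<close>; then \<open>s - d\<close> bounds the infimum from below. Once both are
  real, the extended difference is the ordinary one.\<close>

lemma variation_norm_le:
  assumes "X \<noteq> {}" "\<And>x y. x \<in> X \<Longrightarrow> y \<in> X \<Longrightarrow> f x - f y \<le> d"
  shows "variation_norm X f \<le> ereal d"
proof -
  let ?S = "SUP x\<in>X. ereal (f x)" and ?I = "INF x\<in>X. ereal (f x)"
  obtain z where z: "z \<in> X" using assms(1) by blast
  have S: "?S \<le> ereal (f y + d)" if "y \<in> X" for y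
    using assms(2) that by (intro SUP_least) (simp add: algebra_simps)
  have "ereal (f z) \<le> ?S" using z by (rule SUP_upper)
  then obtain s where s: "?S = ereal s" using S[OF z] by (cases ?S) auto
  have "ereal (s - d) \<le> ?I" using S s by (intro INF_greatest) (simp add: algebra_simps)
  moreover have "?I \<le> ereal (f z)" using z by (rule INF_lower)
  ultimately obtain i where "?I = ereal i" "s - d \<le> i" by (cases ?I) auto
  then show ?thesis using s by (simp add: variation_norm_def)
qed

lemma variation_norm_square_le_iff:
  assumes "X \<noteq> {}" "0 \<le> e"
  shows "(variation_norm X f)\<^sup>2 \<le> ereal e \<longleftrightarrow> (\<forall>x\<in>X. \<forall>y\<in>X. (f x - f y)\<^sup>2 \<le> e)"
proof
  assume L: "(variation_norm X f)\<^sup>2 \<le> ereal e"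
  have "(f x - f y)\<^sup>2 \<le> e" if "x \<in> X" "y \<in> X" for x y
  proof -
    have "ereal \<bar>f x - f y\<bar> \<le> variation_norm X f"
      using variation_norm_ge[of x X y f] variation_norm_ge[of y X x f] that
      by (cases "f x \<le> f y") auto
    then have "(ereal \<bar>f x - f y\<bar>)\<^sup>2 \<le> (variation_norm X f)\<^sup>2"
      unfolding power2_eq_square by (intro ereal_mult_mono) (auto intro: order_trans[rotated])
    from order_trans[OF this L] show ?thesis by (simp add: power2_eq_square)
  qed
  then show "\<forall>x\<in>X. \<forall>y\<in>X. (f x - f y)\<^sup>2 \<le> e" by blast
next
  assume R: "\<forall>x\<in>X. \<forall>y\<in>X. (f x - f y)\<^sup>2 \<le> e"
  have le: "variation_norm X f \<le> ereal (sqrt e)"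
    using R by (intro variation_norm_le[OF assms(1)] real_le_rsqrt) auto
  obtain z where "z \<in> X" using assms(1) by blast
  then have "0 \<le> variation_norm X f" using variation_norm_ge[of z X z f] by (simp add: zero_ereal_def)
  then have "(variation_norm X f)\<^sup>2 \<le> (ereal (sqrt e))\<^sup>2"
    unfolding power2_eq_square using le assms(2) by (intro ereal_mult_mono) (auto intro: order_trans)
  then show "(variation_norm X f)\<^sup>2 \<le> ereal e"
    using assms(2) by (simp add: power2_eq_square)
qed

section \<open>Finite energy, contractions and suprema\<close>

context weighted_graph
begin

lemma finite_energyD:
  assumes "f \<in> finite_energy X b"
  shows "f \<in> extensional X" "(\<lambda>(x, y). b x y * (f x - f y)\<^sup>2) summable_on X \<times> X"
  using assms by (auto simp: finite_energy_def PiE_def)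

lemma sum_le_energy:
  assumes "f \<in> finite_energy X b" "finite F" "F \<subseteq> X \<times> X"
  shows "(\<Sum>(x, y)\<in>F. b x y * (f x - f y)\<^sup>2) \<le> 2 * energy X b f"
proof -
  have "(\<Sum>(x, y)\<in>F. b x y * (f x - f y)\<^sup>2) \<le> (\<Sum>\<^sub>\<infinity>(x, y)\<in>X \<times> X. b x y * (f x - f y)\<^sup>2)"
    by (rule finite_sum_le_infsum[OF finite_energyD(2)[OF assms(1)] assms(2,3)])
      (auto simp: weight_nonneg)
  then show ?thesis by (simp add: energy_def)
qed

lemma edge_le_energy:
  assumes "f \<in> finite_energy X b" "x \<in> X" "y \<in> X"
  shows "b x y * (f x - f y)\<^sup>2 \<le> 2 * energy X b f"
  using sum_le_energy[OF assms(1), of "{(x, y)}"] assms(2,3) by simp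

text \<open>The terms are nonnegative, so a common bound on the finite partial sums gives
  summability and bounds the sum. The factor 2 cancels the 1/2 in \<open>energy\<close>.\<close>

lemma finite_energyI:
  assumes "f \<in> extensional X"
    and "\<And>F. finite F \<Longrightarrow> F \<subseteq> X \<times> X \<Longrightarrow> (\<Sum>(x, y)\<in>F. b x y * (f x - f y)\<^sup>2) \<le> 2 * M"
  shows "f \<in> finite_energy X b" "energy X b f \<le> M"
proof -
  have s: "(\<lambda>(x, y). b x y * (f x - f y)\<^sup>2) summable_on X \<times> X"
  proof (rule nonneg_bdd_above_summable_on)
    show "0 \<le> (case p of (x, y) \<Rightarrow> b x y * (f x - f y)\<^sup>2)" if "p \<in> X \<times> X" for p
      using that by (auto simp: weight_nonneg)
    show "bdd_above (sum (\<lambda>(x, y). b x y * (f x - f y)\<^sup>2) ` {F. F \<subseteq> X \<times> X \<and> finite F})"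
      unfolding bdd_above_def using assms(2) by blast
  qed
  then show "f \<in> finite_energy X b" using assms(1) by (auto simp: finite_energy_def PiE_def)
  show "energy X b f \<le> M"
    using infsum_le_finite_sums[OF s assms(2)] by (simp add: energy_def)
qed

text \<open>The map \<open>u \<mapsto> t * \<bar>u - a\<bar>\<close> has Lipschitz constant
  \<open>\<bar>t\<bar>\<close>, so each term of the energy grows at most by the factor
  \<open>t\<^sup>2\<close>.\<close>

lemma
  assumes "f \<in> finite_energy X b"
  shows finite_energy_abs: "(\<lambda>x\<in>X. t * \<bar>f x - a\<bar>) \<in> finite_energy X b" (is "?g \<in> _")
    and energy_abs_le: "energy X b (\<lambda>x\<in>X. t * \<bar>f x - a\<bar>) \<le> t\<^sup>2 * energy X b f"
proof -
  have contraction: "(t * \<bar>u - a\<bar> - t * \<bar>v - a\<bar>)\<^sup>2 \<le> t\<^sup>2 * (u - v)\<^sup>2" for u v :: real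
  proof -
    have "(\<bar>u - a\<bar> - \<bar>v - a\<bar>)\<^sup>2 \<le> (u - v)\<^sup>2"
      by (rule power2_le_iff_abs_le[THEN iffD2, of "\<bar>u - v\<bar>", simplified]) linarith
    then have "t\<^sup>2 * (\<bar>u - a\<bar> - \<bar>v - a\<bar>)\<^sup>2 \<le> t\<^sup>2 * (u - v)\<^sup>2" by (rule mult_left_mono) simp
    then show ?thesis by (simp add: right_diff_distrib flip: power_mult_distrib)
  qed
  have le: "(\<Sum>(x, y)\<in>F. b x y * (?g x - ?g y)\<^sup>2) \<le> 2 * (t\<^sup>2 * energy X b f)"
    if F: "finite F" "F \<subseteq> X \<times> X" for F
  proof -
    have "(\<Sum>(x, y)\<in>F. b x y * (?g x - ?g y)\<^sup>2)
        \<le> (\<Sum>(x, y)\<in>F. t\<^sup>2 * (b x y * (f x - f y)\<^sup>2))"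
    proof (rule sum_mono, clarify)
      fix x y assume "(x, y) \<in> F"
      then have xy: "x \<in> X" "y \<in> X" using F by auto
      show "b x y * (?g x - ?g y)\<^sup>2 \<le> t\<^sup>2 * (b x y * (f x - f y)\<^sup>2)"
        using mult_left_mono[OF contraction weight_nonneg[OF xy], of "f x" "f y"] xy
        by (simp add: algebra_simps)
    qed
    also have "\<dots> = t\<^sup>2 * (\<Sum>(x, y)\<in>F. b x y * (f x - f y)\<^sup>2)"
      by (simp add: sum_distrib_left case_prod_unfold)
    also have "\<dots> \<le> t\<^sup>2 * (2 * energy X b f)"
      by (intro mult_left_mono sum_le_energy assms F) simp
    finally show ?thesis by simp
  qed
  show "?g \<in> finite_energy X b" "energy X b ?g \<le> t\<^sup>2 * energy X b f"
    using finite_energyI[OF restrict_extensional le] by blast+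
qed

text \<open>The increment of a supremum across an edge is at most the supremum of the increments,
  whose square is at most the sum of all squared increments. Summing over the pairs bounds the
  energy by the sum of the energies.\<close>

lemma finite_energy_SUP:
  fixes g :: "nat \<Rightarrow> 'a \<Rightarrow> real"
  assumes g: "\<And>n. g n \<in> finite_energy X b"
    and summable: "summable (\<lambda>n. energy X b (g n))"
    and bdd: "\<And>x. x \<in> X \<Longrightarrow> bdd_above (range (\<lambda>n. g n x))"
  shows "(\<lambda>x\<in>X. SUP n. g n x) \<in> finite_energy X b" (is "?f \<in> _")
proof -
  let ?q = "\<lambda>x y n. b x y * (g n x - g n y)\<^sup>2"
  have summable_q: "summable (?q x y)" if "x \<in> X" "y \<in> X" for x y
    by (rule summable_comparison_test[OF _ summable_mult[OF summable, of 2]])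
      (use that in \<open>auto simp: weight_nonneg edge_le_energy g intro!: exI[of _ 0]\<close>)
  have edge: "b x y * (?f x - ?f y)\<^sup>2 \<le> suminf (?q x y)" if xy: "x \<in> X" "y \<in> X" for x y
  proof (cases "b x y = 0")
    case True
    then show ?thesis by simp
  next
    case False
    then have b: "0 < b x y" using weight_nonneg[OF xy] by simp
    \<comment> \<open>Dividing by the positive weight gives a bound on the increments that is
      independent of \<open>n\<close>, as \<open>abs_cSUP_diff_le\<close> requires.\<close>
    have "\<bar>g n x - g n y\<bar> \<le> sqrt (suminf (?q x y) / b x y)" for n
    proof (rule real_le_rsqrt)
      have "?q x y n \<le> suminf (?q x y)"
        using sum_le_suminf[OF summable_q[OF xy], of "{n}"] b by simp
      then show "\<bar>g n x - g n y\<bar>\<^sup>2 \<le> suminf (?q x y) / b x y"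
        using b by (simp add: field_simps)
    qed
    then have "\<bar>?f x - ?f y\<bar> \<le> sqrt (suminf (?q x y) / b x y)"
      using xy bdd by (auto intro!: abs_cSUP_diff_le)
    then have "\<bar>?f x - ?f y\<bar>\<^sup>2 \<le> (sqrt (suminf (?q x y) / b x y))\<^sup>2"
      by (rule power_mono) simp
    also have "\<dots> = suminf (?q x y) / b x y"
      using b suminf_nonneg[OF summable_q[OF xy]] by simp
    finally show ?thesis using b by (simp add: field_simps)
  qed
  show ?thesis
  proof (rule finite_energyI(1))
    fix F assume F: "finite F" "F \<subseteq> X \<times> X"
    have "(\<Sum>(x, y)\<in>F. b x y * (?f x - ?f y)\<^sup>2) \<le> (\<Sum>(x, y)\<in>F. suminf (?q x y))"
      using F(2) by (intro sum_mono) (auto intro: edge simp del: restrict_apply restrict_apply')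
    \<comment> \<open>\<open>F\<close> is finite, so the sum over pairs and the series over
      \<open>n\<close> may be exchanged.\<close>
    also have "\<dots> = (\<Sum>n. \<Sum>(x, y)\<in>F. ?q x y n)"
      unfolding case_prod_unfold using F(2) by (intro suminf_sum[symmetric] summable_q) auto
    also have "\<dots> \<le> (\<Sum>n. 2 * energy X b (g n))"
    proof (rule suminf_le[OF sum_le_energy[OF g F] _ summable_mult[OF summable]])
      show "summable (\<lambda>n. \<Sum>(x, y)\<in>F. ?q x y n)"
        unfolding case_prod_unfold using F(2) by (intro summable_sum summable_q) auto
    qed
    finally show "(\<Sum>(x, y)\<in>F. b x y * (?f x - ?f y)\<^sup>2) \<le> 2 * (\<Sum>n. energy X b (g n))"
      by (simp add: suminf_mult[OF summable])
  qed simp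
qed

section \<open>From bounds along paths to a uniform bound\<close>

lemma connected_pointwise_bound:
  assumes "connected_graph X b" "x \<in> X" "y \<in> X"
  obtains C where "\<And>f. f \<in> finite_energy X b \<Longrightarrow> \<bar>f x - f y\<bar> \<le> C * sqrt (energy X b f)"
proof -
  obtain k :: nat and p where p: "p 0 = x" "p k = y" "\<forall>j\<le>k. p j \<in> X"
    "\<forall>j<k. 0 < b (p j) (p (Suc j))"
    using assms unfolding connected_graph_def by blast
  \<comment> \<open>Induction along the path: the energy controls the increment across each edge of
    positive weight, and the constants add up.\<close>
  have "\<exists>C. \<forall>f\<in>finite_energy X b. \<bar>f x - f (p j)\<bar> \<le> C * sqrt (energy X b f)" if "j \<le> k" for j
    using that
  proof (induction j)
    case 0
    then show ?case using p(1) by (intro exI[of _ 0]) simp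
  next
    case (Suc j)
    then obtain C where C: "\<And>f. f \<in> finite_energy X b \<Longrightarrow>
        \<bar>f x - f (p j)\<bar> \<le> C * sqrt (energy X b f)" by auto
    let ?b = "b (p j) (p (Suc j))"
    have b: "0 < ?b" and X: "p j \<in> X" "p (Suc j) \<in> X" using p Suc.prems by auto
    show ?case
    proof (intro exI ballI)
      fix f assume f: "f \<in> finite_energy X b"
      have "\<bar>f (p j) - f (p (Suc j))\<bar> \<le> sqrt (2 / ?b * energy X b f)"
        using edge_le_energy[OF f X] b by (intro real_le_rsqrt) (simp add: field_simps)
      then show "\<bar>f x - f (p (Suc j))\<bar> \<le> (C + sqrt (2 / ?b)) * sqrt (energy X b f)"
        using C[OF f] unfolding real_sqrt_mult distrib_right by linarith
    qed
  qed
  from this[of k] show thesis using p(2) that by auto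
qed

lemma bounded_functions_imp_uniform_bound:
  assumes connected: "connected_graph X b"
    and bounded: "finite_energy X b \<subseteq> bounded_functions X"
    and z: "z \<in> X"
  shows "\<exists>C. \<forall>f\<in>finite_energy X b. \<forall>x\<in>X. (f x - f z)\<^sup>2 \<le> C * energy X b f"
proof (rule ccontr)
  assume no_bound: "\<not> ?thesis"
  have "\<exists>g x. g \<in> finite_energy X b \<and> x \<in> X \<and> g z = 0 \<and> 2 ^ n \<le> g x \<and>
      energy X b g \<le> (1 / 4) ^ n" for n :: nat
  proof -
    \<comment> \<open>The constant \<open>16 ^ n\<close> has the root
      \<open>4 ^ n = 2 ^ n * 2 ^ n\<close>: one factor makes the energy small, the other remains as
      growth.\<close>
    obtain f x where f: "f \<in> finite_energy X b" and x: "x \<in> X"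
      and large: "16 ^ n * energy X b f < (f x - f z)\<^sup>2"
      using no_bound unfolding not_ex not_all not_le bex_simps ball_simps by (meson not_le)
    \<comment> \<open>At zero energy \<open>f\<close> would be constant, against the strict
      inequality \<open>large\<close>.\<close>
    have "energy X b f \<noteq> 0"
      using energy_zero_imp_const[OF connected f _ x z] large by auto
    then have pos: "0 < energy X b f" using energy_nonneg[of f] by linarith
    define t where "t = 1 / (2 ^ n * sqrt (energy X b f))"
    have "4 ^ n * sqrt (energy X b f) \<le> \<bar>f x - f z\<bar>"
    proof (rule power2_le_imp_le)
      have "((4::real) ^ n)\<^sup>2 = 16 ^ n" by (simp add: power2_eq_square flip: power_mult_distrib)
      then show "(4 ^ n * sqrt (energy X b f))\<^sup>2 \<le> \<bar>f x - f z\<bar>\<^sup>2"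
        using large pos by (simp add: power_mult_distrib)
    qed simp
    moreover have "(4::real) ^ n = 2 ^ n * 2 ^ n" by (simp flip: power_mult_distrib)
    ultimately have "2 ^ n \<le> t * \<bar>f x - f z\<bar>"
      using pos by (simp add: t_def field_simps)
    moreover have "t\<^sup>2 * energy X b f = (1 / 4) ^ n"
    proof -
      have "((2::real) ^ n)\<^sup>2 = 4 ^ n" by (simp add: power2_eq_square flip: power_mult_distrib)
      then show ?thesis using pos by (simp add: t_def power_mult_distrib power_divide)
    qed
    ultimately show ?thesis
      using finite_energy_abs[OF f, of t "f z"] energy_abs_le[OF f, of t "f z"] x z
      by (intro exI[of _ "\<lambda>x\<in>X. t * \<bar>f x - f z\<bar>"] exI[of _ x]) simp
  qed
  then obtain g x where g: "\<And>n. g n \<in> finite_energy X b" and x: "\<And>n. x n \<in> X"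
    and gz: "\<And>n. g n z = 0" and gx: "\<And>n::nat. 2 ^ n \<le> g n (x n)"
    and energy: "\<And>n. energy X b (g n) \<le> (1 / 4) ^ n"
    by metis
  \<comment> \<open>All energies are at most 1, so the bound along a path from \<open>y\<close> to
    \<open>z\<close> is the same for every \<open>n\<close>. The sign of \<open>C\<close> is
    unknown, hence \<open>\<bar>C\<bar>\<close>.\<close>
  have bdd: "bdd_above (range (\<lambda>n. g n y))" if y: "y \<in> X" for y
  proof -
    obtain C where C: "\<And>f. f \<in> finite_energy X b \<Longrightarrow> \<bar>f y - f z\<bar> \<le> C * sqrt (energy X b f)"
      using connected_pointwise_bound[OF connected y z] by blast
    have "g n y \<le> \<bar>C\<bar>" for n
    proof -
      have "sqrt (energy X b (g n)) \<le> 1"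
        using order_trans[OF energy power_le_one[of "1 / 4" n]] by simp
      then have "C * sqrt (energy X b (g n)) \<le> \<bar>C\<bar> * 1"
        by (intro mult_mono) (auto simp: energy_nonneg)
      then show ?thesis using C[OF g[of n]] gz[of n] by simp
    qed
    then show ?thesis by (auto intro: bdd_aboveI[of _ "\<bar>C\<bar>"])
  qed
  define f where "f = (\<lambda>y\<in>X. SUP n. g n y)"
  have "summable (\<lambda>n. energy X b (g n))"
    by (rule summable_comparison_test[OF _ summable_geometric[of "1 / 4 :: real"]])
      (auto simp: energy_nonneg energy intro!: exI[of _ 0])
  then have "f \<in> finite_energy X b" unfolding f_def by (intro finite_energy_SUP g bdd)
  then have "bounded (f ` X)" using bounded by (auto simp: bounded_functions_def)
  then obtain B where B: "\<And>y. y \<in> X \<Longrightarrow> \<bar>f y\<bar> \<le> B" by (auto simp: bounded_iff)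
  obtain n :: nat where n: "B < 2 ^ n" using real_arch_pow[of 2 B] by auto
  \<comment> \<open>The supremum dominates each \<open>g n\<close>, so it is at least
    \<open>2 ^ n\<close> at \<open>x n\<close> and exceeds \<open>B\<close>.\<close>
  have "g n (x n) \<le> f (x n)" using x bdd by (auto simp: f_def intro!: cSUP_upper)
  then show False using B[OF x[of n]] gx[of n] n by linarith
qed

section \<open>Reduction of the statements to the uniform bound\<close>

lemma bounded_functions_iff_uniform_bound:
  assumes "connected_graph X b"
  shows "finite_energy X b \<subseteq> bounded_functions X \<longleftrightarrow>
      (\<exists>c>0. \<forall>f\<in>finite_energy X b. \<forall>x\<in>X. \<forall>y\<in>X. (f x - f y)\<^sup>2 \<le> c * energy X b f)"
    (is "?bounded \<longleftrightarrow> ?uniform")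
proof
  assume ?bounded
  obtain z where z: "z \<in> X" using vertices_nonempty by blast
  obtain C where C: "\<And>f x. f \<in> finite_energy X b \<Longrightarrow> x \<in> X \<Longrightarrow>
      (f x - f z)\<^sup>2 \<le> C * energy X b f"
    using bounded_functions_imp_uniform_bound[OF assms \<open>?bounded\<close> z] by blast
  \<comment> \<open>Passing through \<open>z\<close> costs the factor 4; the absolute value and the
    summand 1 make the constant positive.\<close>
  have "(f x - f y)\<^sup>2 \<le> (4 * \<bar>C\<bar> + 1) * energy X b f"
    if f: "f \<in> finite_energy X b" and xy: "x \<in> X" "y \<in> X" for f x y
  proof -
    have "(f x - f y)\<^sup>2 \<le> 2 * (f x - f z)\<^sup>2 + 2 * (f y - f z)\<^sup>2"
      using zero_le_power2[of "(f x - f z) + (f y - f z)"]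
      by (simp add: power2_eq_square algebra_simps)
    also have "\<dots> \<le> 4 * (C * energy X b f)" using C[OF f xy(1)] C[OF f xy(2)] by linarith
    also have "\<dots> \<le> (4 * \<bar>C\<bar> + 1) * energy X b f"
      using mult_right_mono[of "4 * C" "4 * \<bar>C\<bar> + 1", OF _ energy_nonneg[of f]]
      by (simp add: mult.assoc)
    finally show ?thesis .
  qed
  then show ?uniform by (intro exI[of _ "4 * \<bar>C\<bar> + 1"]) auto
next
  assume ?uniform
  then obtain c where c: "\<And>f x y. f \<in> finite_energy X b \<Longrightarrow> x \<in> X \<Longrightarrow> y \<in> X \<Longrightarrow>
      (f x - f y)\<^sup>2 \<le> c * energy X b f" by blast
  show ?bounded
  proof
    fix f assume f: "f \<in> finite_energy X b"
    obtain z where z: "z \<in> X" using vertices_nonempty by blast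
    have "\<bar>f x\<bar> \<le> \<bar>f z\<bar> + sqrt (c * energy X b f)" if "x \<in> X" for x
    proof -
      have "\<bar>f x - f z\<bar> \<le> sqrt (c * energy X b f)"
        using c[OF f that z] by (intro real_le_rsqrt) simp
      then show ?thesis by linarith
    qed
    then have "bounded (f ` X)" by (auto simp: bounded_iff)
    then show "f \<in> bounded_functions X"
      using finite_energyD(1)[OF f] by (simp add: bounded_functions_def PiE_def)
  qed
qed

text \<open>By \<open>resistance_smallest\<close> the resistance is itself an admissible constant
  for its pair of vertices, so a finite diameter is admissible for all pairs, and any uniform
  constant bounds every resistance.\<close>

lemma resistance_diameter_finite_iff_uniform_bound:
  assumes "connected_graph X b"
  shows "resistance_diameter X b < \<infinity> \<longleftrightarrow>
      (\<exists>c>0. \<forall>f\<in>finite_energy X b. \<forall>x\<in>X. \<forall>y\<in>X. (f x - f y)\<^sup>2 \<le> c * energy X b f)"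
    (is "?finite \<longleftrightarrow> ?uniform")
proof
  assume ?finite
  define C where "C = enn2real (resistance_diameter X b)"
  have C: "resistance_diameter X b = ennreal C" "0 \<le> C"
    using \<open>?finite\<close> by (simp_all add: C_def)
  \<comment> \<open>\<open>C\<close> is 0 for a single vertex, while the constant must be
    positive.\<close>
  have "(f x - f y)\<^sup>2 \<le> (C + 1) * energy X b f"
    if f: "f \<in> finite_energy X b" and xy: "x \<in> X" "y \<in> X" for f x y
  proof -
    have "resistance X b x y \<le> ennreal C"
      unfolding C(1)[symmetric] resistance_diameter_def
      using xy by (intro SUP_upper2[of x] SUP_upper2[of y]) auto
    then have "ennreal (\<bar>f x - f y\<bar>\<^sup>2) \<le> ennreal C * ennreal (energy X b f)"
      using resistance_smallest(1)[OF assms xy f] mult_right_mono order_trans by fastforce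
    then have "(f x - f y)\<^sup>2 \<le> C * energy X b f"
      using C(2) energy_nonneg[of f] by (simp flip: ennreal_mult)
    then show ?thesis using energy_nonneg[of f] by (simp add: distrib_right)
  qed
  then show ?uniform using C(2) by (intro exI[of _ "C + 1"]) auto
next
  assume ?uniform
  then obtain c where c: "0 < c" "\<And>f x y. f \<in> finite_energy X b \<Longrightarrow> x \<in> X \<Longrightarrow> y \<in> X \<Longrightarrow>
      (f x - f y)\<^sup>2 \<le> c * energy X b f" by blast
  have "resistance_diameter X b \<le> ennreal c"
    unfolding resistance_diameter_def
    by (intro SUP_least resistance_smallest(2)[OF assms])
      (use c energy_nonneg in \<open>auto simp flip: ennreal_mult intro!: ennreal_leI\<close>)
  then show ?finite using le_less_trans by fastforce
qed

end

theorem theorem3p2: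
  fixes X :: "'a set" and b :: "'a \<Rightarrow> 'a \<Rightarrow> real"
  assumes "weighted_graph X b" and "connected_graph X b"
  shows "((\<exists>c>0. \<forall>f\<in>finite_energy X b. (variation_norm X f)\<^sup>2 \<le> ereal (c * energy X b f))
            \<longleftrightarrow> finite_energy X b \<subseteq> bounded_functions X)
       \<and> (finite_energy X b \<subseteq> bounded_functions X
            \<longleftrightarrow> resistance_diameter X b < \<infinity>)"
proof -
  interpret weighted_graph X b by fact
  \<comment> \<open>For positive \<open>c\<close> the right-hand side is nonnegative, so
    \<open>variation_norm_square_le_iff\<close> turns the variation bound into the uniform
    bound.\<close>
  have "(\<forall>f\<in>finite_energy X b. (variation_norm X f)\<^sup>2 \<le> ereal (c * energy X b f)) \<longleftrightarrow>
      (\<forall>f\<in>finite_energy X b. \<forall>x\<in>X. \<forall>y\<in>X. (f x - f y)\<^sup>2 \<le> c * energy X b f)" if "0 < c" for c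
    using that by (simp add: variation_norm_square_le_iff[OF vertices_nonempty] energy_nonneg)
  then show ?thesis
    unfolding bounded_functions_iff_uniform_bound[OF assms(2)]
      resistance_diameter_finite_iff_uniform_bound[OF assms(2)] by blast
qed

end
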